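(* The mapping $\rho:U_q(\mathrm{gl}(2/1))\to\mathcal W$ defined by the formulae $$\rho(E_{12})=a^+,$$ $$\rho(E_{13})=q^{-x}b^+,$$ $$\rho(E_{23})=-q\,a\,b^+ +q^x(bb^+ +q\,b^+b)\,e_{23},$$ $$\rho(K_1)=q^{\lambda_1+x}(bb^+ +q\,b^+b),$$ $$\rho(K_2)=q^{-x}k_2,$$ $$\rho(K_3)=(bb^+ +q^{-1}b^+b)\,k_3,$$ $$\rho(E_{32})=q^{-1}a^+b\,k_2k_3+e_{32},$$ $$\rho(E_{21})=-\frac{a}{q-q^{-1}}\Bigl(q^{\lambda_1+x-1}(bb^+ +q\,b^+b)k_2^{-1}-q^{-\lambda_1-x+1}(bb^+ +q^{-1}b^+b)k_2\Bigr)-q^{-\lambda_1}b\,e_{23}k_2,$$ $$\rho(E_{31})=a^+a\,b\,q^{\lambda_1+x-1}k_3+a\,q^{\lambda_1+x-2}(bb^+ +q\,b^+b)k_2^{-1}e_{32}+q^{-1}b\,\frac{q^{\lambda_1}k_3-q^{-\lambda_1}k_3^{-1}}{q-q^{-1}}$$ (with $\rho(K_i^{-1})=\rho(K_i)^{-1}$) is a realization of the quantum superalgebra $U_q(\mathrm{gl}(2/1))$, i.e. it is a homomorphism of associative superalgebras from $U_q(\mathrm{gl}(2/1))$ to $\mathcal W$.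
   Context: Let $q$ be an independent variable and let $\mathcal C(q)$ be the field of fractions of $\mathbb C[q,q^{-1}]$. Notation: $[A,B]=AB-BA$ and $\{A,B\}=AB+BA$. The quantum superalgebra $U_q(\mathrm{gl}(2/1))$ is the (unital) associative superalgebra over $\mathcal C(q)$ generated by even generators $K_i,K_i^{-1}$ ($i=1,2,3$), $E_{12},E_{21}$ and odd generators $E_{23},E_{32}$ subject to the relations $K_i^{\pm1}K_j^{\pm1}=K_j^{\pm1}K_i^{\pm1}$, $K_iK_i^{-1}=1$; $K_iE_{jk}=q^{\delta_{ij}-\delta_{ik}}E_{jk}K_i$; $[E_{12},E_{32}]=[E_{21},E_{23}]=0$; $[E_{12},E_{21}]=\dfrac{K_1K_2^{-1}-K_1^{-1}K_2}{q-q^{-1}}$; $\{E_{23},E_{32}\}=\dfrac{K_2K_3-K_2^{-1}K_3^{-1}}{q-q^{-1}}$; $E_{23}^2=E_{32}^2=0$; $E_{12}E_{13}-qE_{13}E_{12}=0$, $E_{21}E_{31}-qE_{31}E_{21}=0$, where $E_{13}=E_{12}E_{23}-q^{-1}E_{23}E_{12}$ and $E_{31}=-E_{21}E_{32}+q^{-1}E_{32}E_{21}$. The algebra $\mathcal H$ of $q$-deformed boson operators is the associative algebra over $\mathcal C(q)$ generated by $a^+$, $a$, $q^x$, $q^{-x}$ with relations $q^xq^{-x}=q^{-x}q^x=1$, $q^xa^+q^{-x}=qa^+$, $q^xaq^{-x}=q^{-1}a$, $aa^+-q^{-1}a^+a=q^x$, $aa^+-qa^+a=q^{-x}$. (Here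 $q^{\pm x}$ are just names of generators.) All elements of $\mathcal H$ are even. The fermion elements $b^+$, $b$ (also written $b^{\pm}$, with $b^-=b$) are odd and satisfy $bb=b^+b^+=0$, $bb^++b^+b=1$. $U_q(\mathrm{gl}(1/1))$ is the quantum superalgebra generated by even $k_2^{\pm1},k_3^{\pm1}$ and odd $e_{23},e_{32}$, satisfying the relations of the sub-superalgebra of $U_q(\mathrm{gl}(2/1))$ generated by $K_2^{\pm1},K_3^{\pm1},E_{23},E_{32}$: the $k$'s commute, $k_ik_i^{-1}=1$, $k_ie_{jl}=q^{\delta_{ij}-\delta_{il}}e_{jl}k_i$ for $i\in\{2,3\}$ and $(j,l)\in\{(2,3),(3,2)\}$, $\{e_{23},e_{32}\}=\dfrac{k_2k_3-k_2^{-1}k_3^{-1}}{q-q^{-1}}$, $e_{23}^2=e_{32}^2=0$. $\mathcal W$ is the associative superalgebra generated by $\mathcal H$, $b^{\pm}$ and $U_q(\mathrm{gl}(1/1))$, where elements of $\mathcal H$ commute with $b^{\pm}$ and with all elements of $U_q(\mathrm{gl}(1/1))$, and $y\,b^{\pm}=(-1)^{\deg y}b^{\pm}y$ for every homogeneous $y\in U_q(\mathrm{gl}(1/1))$. $\lambda_1$ is a parameter; $q^{\pm\lambda_1}$ denotes a pair of mutually inverse scalars (the scalars being extended if $q^{\lambda_1}\notin\mathcal C(q)$), and $q^{\pm\lambda_1\pm x+m}$ means $q^{\pm\lambda_1}q^{\pm x}q^{m}$ for an integer $m$. A realization of $U_q(\mathrm{gl}(2/1))$ means a homomorphism $\rho$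 from $U_q(\mathrm{gl}(2/1))$ to $\mathcal W$. *)

theory Defs
  imports
    "HOL-Library.Poly_Mapping"
    "HOL-Library.Z2"
    "HOL-Computational_Algebra.Fraction_Field"
    "HOL-Computational_Algebra.Polynomial"
    "HOL-Algebra.QuotRing"
    "HOL-Algebra.Module"
    "HOL-Algebra.Algebraic_Closure_Type"
begin

section \<open>Free associative algebras\<close>

datatype 'g word = Word (letters: "'g list")

instantiation word :: (type) monoid_add
begin

definition zero_word :: "'a word" where
  "0 = Word []"

definition plus_word :: "'a word \<Rightarrow> 'a word \<Rightarrow> 'a word" where
  "u + v = Word (letters u @ letters v)"

instance
  by standard (auto simp: zero_word_def plus_word_def)

end

text \<open>
  The multiplication of \<^typ>\<open>'g word \<Rightarrow>\<^sub>0 'k\<close> is convolution with respect to concatenation of words,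
  so this type is the free associative unital algebra over \<^typ>\<open>'k\<close> on the generators \<^typ>\<open>'g\<close>.
\<close>

type_synonym ('g, 'k) free_alg = "'g word \<Rightarrow>\<^sub>0 'k"

definition gen :: "'g \<Rightarrow> ('g, 'k::field) free_alg" where
  "gen g = Poly_Mapping.single (Word [g]) 1"

definition scal :: "'k::field \<Rightarrow> ('g, 'k) free_alg" where
  "scal c = Poly_Mapping.single 0 c"

abbreviation scale :: "'k::field \<Rightarrow> ('g, 'k) free_alg \<Rightarrow> ('g, 'k) free_alg"  (infixr "\<cdot>" 75) where
  "c \<cdot> f \<equiv> scal c * f"

text \<open>The parity of a word is the sum in \<open>\<int>/2\<close> of the parities of its letters.\<close>

definition free_comp :: "('g \<Rightarrow> bit) \<Rightarrow> bit \<Rightarrow> ('g, 'k::field) free_alg set" where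
  "free_comp par p = {f. \<forall>w\<in>Poly_Mapping.keys f. (\<Sum>g\<leftarrow>letters w. par g) = p}"

text \<open>The subalgebra of the free algebra generated by a subset of the generators.\<close>

definition free_sub :: "'g set \<Rightarrow> ('g, 'k::field) free_alg set" where
  "free_sub S = {f. \<forall>w\<in>Poly_Mapping.keys f. set (letters w) \<subseteq> S}"


section \<open>Superalgebras given by generators and relations\<close>

text \<open>
  \<open>hcomp A 0\<close> and \<open>hcomp A 1\<close> are the even and the odd part of \<open>A\<close>.
\<close>

record ('k, 'a) superalgebra = "('k, 'a) module" +
  hcomp :: "bit \<Rightarrow> 'a set"

definition superalgebra_hom ::
  "('k, 'a) superalgebra \<Rightarrow> ('k, 'b) superalgebra \<Rightarrow> ('a \<Rightarrow> 'b) set" where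
  "superalgebra_hom A B =
     {h \<in> ring_hom A B.
        (\<forall>c. \<forall>x\<in>carrier A. h (c \<odot>\<^bsub>A\<^esub> x) = c \<odot>\<^bsub>B\<^esub> h x) \<and>
        (\<forall>p. h ` hcomp A p \<subseteq> hcomp B p)}"

text \<open>
  A set \<open>R\<close> of elements of the free algebra stands for the relations \<open>r = 0\<close>, \<open>r \<in> R\<close>.
  In the non-commutative ring at hand \<^const>\<open>genideal\<close> yields the two-sided ideal generated by \<open>R\<close>.
\<close>

definition rel_ideal :: "('g, 'k::field) free_alg set \<Rightarrow> ('g, 'k) free_alg set" where
  "rel_ideal R = Idl\<^bsub>ring_of_type_algebra\<^esub> R"

definition cls :: "('g, 'k::field) free_alg set \<Rightarrow> ('g, 'k) free_alg \<Rightarrow> ('g, 'k) free_alg set" where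
  "cls R f = rel_ideal R +>\<^bsub>ring_of_type_algebra\<^esub> f"

definition presented ::
  "('g \<Rightarrow> bit) \<Rightarrow> ('g, 'k::field) free_alg set \<Rightarrow> ('k, ('g, 'k) free_alg set) superalgebra" where
  "presented par R =
     (let Q = ring_of_type_algebra Quot rel_ideal R in
      \<lparr>carrier = carrier Q, monoid.mult = monoid.mult Q, one = one Q, zero = zero Q, add = add Q,
       module.smult = (\<lambda>c x. cls R (scal c) \<otimes>\<^bsub>Q\<^esub> x),
       hcomp = (\<lambda>p. cls R ` free_comp par p)\<rparr>)"


section \<open>The scalars\<close>

text \<open>
  The field of fractions of \<open>\<complex>[q, q\<^sup>-\<^sup>1]\<close> is that of \<open>\<complex>[q]\<close>.
\<close>

definition qvar :: "complex poly fract" where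
  "qvar = Fract [:0, 1:] 1"

text \<open>
  The algebras below are defined over an arbitrary field \<^typ>\<open>'k\<close> with an element \<open>q\<close>; they are to be used
  with an extension field of \<^typ>\<open>complex poly fract\<close> and \<open>q\<close> the image of \<^const>\<open>qvar\<close>.
\<close>


section \<open>The quantum superalgebra \<open>U\<^sub>q(gl(2/1))\<close>\<close>

datatype ix = I1 | I2 | I3

datatype ugen = K ix | Kinv ix | E12 | E21 | E23 | E32

fun upar :: "ugen \<Rightarrow> bit" where
  "upar E23 = 1"
| "upar E32 = 1"
| "upar _ = 0"

definition elem13 :: "'k::field \<Rightarrow> (ugen, 'k) free_alg" where
  "elem13 q = gen E12 * gen E23 - inverse q \<cdot> (gen E23 * gen E12)"

definition elem31 :: "'k::field \<Rightarrow> (ugen, 'k) free_alg" where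
  "elem31 q = - (gen E21 * gen E32) + inverse q \<cdot> (gen E32 * gen E21)"

definition gl21_rels :: "'k::field \<Rightarrow> (ugen, 'k) free_alg set" where
  "gl21_rels q =
     {gen g * gen h - gen h * gen g | g h. g \<in> range K \<union> range Kinv \<and> h \<in> range K \<union> range Kinv}
   \<union> {gen (K i) * gen (Kinv i) - 1 | i. True}
   \<union> {gen (K i) * gen e - q powi (of_bool (i = j) - of_bool (i = k)) \<cdot> (gen e * gen (K i)) | i e j k.
        (e, j, k) \<in> {(E12, I1, I2), (E21, I2, I1), (E23, I2, I3), (E32, I3, I2)}}
   \<union> {gen E12 * gen E32 - gen E32 * gen E12,
      gen E21 * gen E23 - gen E23 * gen E21,
      (gen E12 * gen E21 - gen E21 * gen E12)
        - inverse (q - inverse q) \<cdot> (gen (K I1) * gen (Kinv I2) - gen (Kinv I1) * gen (K I2)),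
      (gen E23 * gen E32 + gen E32 * gen E23)
        - inverse (q - inverse q) \<cdot> (gen (K I2) * gen (K I3) - gen (Kinv I2) * gen (Kinv I3)),
      gen E23 * gen E23,
      gen E32 * gen E32,
      gen E12 * elem13 q - q \<cdot> (elem13 q * gen E12),
      gen E21 * elem31 q - q \<cdot> (elem31 q * gen E21)}"

definition Uq_gl21 :: "'k::field \<Rightarrow> ('k, (ugen, 'k) free_alg set) superalgebra" where
  "Uq_gl21 q = presented upar (gl21_rels q)"

definition ucls :: "'k::field \<Rightarrow> (ugen, 'k) free_alg \<Rightarrow> (ugen, 'k) free_alg set" where
  "ucls q = cls (gl21_rels q)"


section \<open>The superalgebra \<open>W\<close>\<close>

datatype wgen =
    Aplus | Aminus | Qx | Qxinv
  | Bplus | Bminus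
  | Gk2 | Gk2inv | Gk3 | Gk3inv | Ge23 | Ge32

fun wpar :: "wgen \<Rightarrow> bit" where
  "wpar Bplus = 1"
| "wpar Bminus = 1"
| "wpar Ge23 = 1"
| "wpar Ge32 = 1"
| "wpar _ = 0"

abbreviation ap :: "(wgen, 'k::field) free_alg" where "ap \<equiv> gen Aplus"
abbreviation am :: "(wgen, 'k::field) free_alg" where "am \<equiv> gen Aminus"
abbreviation qx :: "(wgen, 'k::field) free_alg" where "qx \<equiv> gen Qx"
abbreviation qxi :: "(wgen, 'k::field) free_alg" where "qxi \<equiv> gen Qxinv"
abbreviation bp :: "(wgen, 'k::field) free_alg" where "bp \<equiv> gen Bplus"
abbreviation bm :: "(wgen, 'k::field) free_alg" where "bm \<equiv> gen Bminus"
abbreviation k2 :: "(wgen, 'k::field) free_alg" where "k2 \<equiv> gen Gk2"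
abbreviation k2i :: "(wgen, 'k::field) free_alg" where "k2i \<equiv> gen Gk2inv"
abbreviation k3 :: "(wgen, 'k::field) free_alg" where "k3 \<equiv> gen Gk3"
abbreviation k3i :: "(wgen, 'k::field) free_alg" where "k3i \<equiv> gen Gk3inv"
abbreviation e23 :: "(wgen, 'k::field) free_alg" where "e23 \<equiv> gen Ge23"
abbreviation e32 :: "(wgen, 'k::field) free_alg" where "e32 \<equiv> gen Ge32"

definition H_gens :: "wgen set" where
  "H_gens = {Aplus, Aminus, Qx, Qxinv}"

definition b_gens :: "wgen set" where
  "b_gens = {Bplus, Bminus}"

definition gl11_gens :: "wgen set" where
  "gl11_gens = {Gk2, Gk2inv, Gk3, Gk3inv, Ge23, Ge32}"

definition H_rels :: "'k::field \<Rightarrow> (wgen, 'k) free_alg set" where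
  "H_rels q =
     {qx * qxi - 1,
      qxi * qx - 1,
      qx * ap * qxi - q \<cdot> ap,
      qx * am * qxi - inverse q \<cdot> am,
      am * ap - inverse q \<cdot> (ap * am) - qx,
      am * ap - q \<cdot> (ap * am) - qxi}"

definition b_rels :: "(wgen, 'k::field) free_alg set" where
  "b_rels = {bm * bm, bp * bp, bm * bp + bp * bm - 1}"

definition gl11_rels :: "'k::field \<Rightarrow> (wgen, 'k) free_alg set" where
  "gl11_rels q =
     {gen g * gen h - gen h * gen g | g h.
        g \<in> {Gk2, Gk2inv, Gk3, Gk3inv} \<and> h \<in> {Gk2, Gk2inv, Gk3, Gk3inv}}
   \<union> {k2 * k2i - 1, k3 * k3i - 1}
   \<union> {gen g * gen e - q powi (of_bool (i = j) - of_bool (i = l)) \<cdot> (gen e * gen g) | g i e j l.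
        (g, i) \<in> {(Gk2, I2), (Gk3, I3)} \<and> (e, j, l) \<in> {(Ge23, I2, I3), (Ge32, I3, I2)}}
   \<union> {(e23 * e32 + e32 * e23) - inverse (q - inverse q) \<cdot> (k2 * k3 - k2i * k3i),
      e23 * e23,
      e32 * e32}"

text \<open>
  The mixed relations: \<open>H\<close> commutes with \<open>b\<^sup>\<plusminus>\<close> and with \<open>U\<^sub>q(gl(1/1))\<close>, and
  \<open>y b\<^sup>\<plusminus> = (-1)\<^bsup>deg y\<^esup> b\<^sup>\<plusminus> y\<close> for homogeneous \<open>y\<close> in \<open>U\<^sub>q(gl(1/1))\<close>.
\<close>

definition mixed_rels :: "(wgen, 'k::field) free_alg set" where
  "mixed_rels =
     {h * gen g - gen g * h | h g. h \<in> free_sub H_gens \<and> g \<in> b_gens}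
   \<union> {h * y - y * h | h y. h \<in> free_sub H_gens \<and> y \<in> free_sub gl11_gens}
   \<union> {y * gen g - (if p = 0 then 1 else - 1) \<cdot> (gen g * y) | y g p.
        y \<in> free_sub gl11_gens \<inter> free_comp wpar p \<and> g \<in> b_gens}"

definition W_rels :: "'k::field \<Rightarrow> (wgen, 'k) free_alg set" where
  "W_rels q = H_rels q \<union> b_rels \<union> gl11_rels q \<union> mixed_rels"

definition W_alg :: "'k::field \<Rightarrow> ('k, (wgen, 'k) free_alg set) superalgebra" where
  "W_alg q = presented wpar (W_rels q)"

definition wcls :: "'k::field \<Rightarrow> (wgen, 'k) free_alg \<Rightarrow> (wgen, 'k) free_alg set" where
  "wcls q = cls (W_rels q)"

end

theory Submission
  imports Defs
begin

text \<open>
  By the universal property of the free algebra it suffices that the images of the generators respect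
  the parity and satisfy the defining relations of \<open>U\<^sub>q(gl(2/1))\<close> modulo those of \<open>W\<close>; uniqueness holds
  because the generators generate.  Modulo the relations, every element of \<open>W\<close> is a combination of
  ordered monomials (first \<open>H\<close>, then \<open>b\<^sup>\<plusminus>\<close>, then \<open>U\<^sub>q(gl(1/1))\<close>), and each relation is an identity
  between the coefficients of such monomials.  In order to rewrite with equations instead of
  congruences, the quotient is identified with a linear complement of the relation ideal, on which the
  generators act as linear operators.
\<close>

section \<open>The free algebra\<close>

lemma scal_add: "scal (c + d) = scal c + scal d"
  by (simp add: scal_def single_add)

lemma scal_uminus: "scal (- c) = - scal c"
  by (simp add: scal_def single_uminus)

lemma scal_diff: "scal (c - d) = scal c - scal d"
  by (simp add: scal_def single_diff)

lemma scal_mult: "scal (c * d) = scal c * scal d"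
  by (simp add: scal_def mult_single)

lemma scal_0 [simp]: "scal 0 = 0"
  by (simp add: scal_def)

lemma scal_1 [simp]: "scal 1 = 1"
  by (simp add: scal_def)

lemma lookup_scale: "Poly_Mapping.lookup (c \<cdot> f) w = c * Poly_Mapping.lookup f w"
  by (simp add: scal_def mult_map_scale_conv_mult[symmetric] Poly_Mapping.map.rep_eq when_def)

text \<open>Every element is a finite sum of monomials, so an additive property has to be checked on
  monomials only. For identities about products the induction is nested.\<close>

lemma free_alg_induct [case_names single add]:
  assumes "\<And>w c. P (Poly_Mapping.single w c)"
    and "\<And>f g. P f \<Longrightarrow> P g \<Longrightarrow> P (f + g)"
  shows "P (f :: ('g, 'k::field) free_alg)"
proof (induction f rule: Poly_Mapping.update_induct)
  case const
  show ?case using assms(1)[of 0 0] by simp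
next
  case (update f a b)
  have "Poly_Mapping.update a b f = f + Poly_Mapping.single a b"
    using update(1) by (intro poly_mapping_eqI)
      (auto simp: lookup_update lookup_add lookup_single when_def in_keys_iff)
  then show ?case using assms update by metis
qed

lemma scal_central: "f * scal c = c \<cdot> (f :: ('g, 'k::field) free_alg)"
  by (induction f rule: free_alg_induct) (simp_all add: scal_def mult_single algebra_simps)

lemma scale_left_commute: "f * (c \<cdot> g) = c \<cdot> (f * (g :: ('g, 'k::field) free_alg))"
  by (metis mult.assoc scal_central)

section \<open>Substitution homomorphisms between free algebras\<close>

definition word_prod :: "('g \<Rightarrow> ('h, 'k::field) free_alg) \<Rightarrow> 'g word \<Rightarrow> ('h, 'k) free_alg" where
  "word_prod \<theta> w = prod_list (map \<theta> (letters w))"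

text \<open>The unique extension of \<open>\<theta>\<close> to a homomorphism of unital algebras,
  written out on monomials.\<close>

definition free_eval :: "('g \<Rightarrow> ('h, 'k::field) free_alg) \<Rightarrow> ('g, 'k) free_alg \<Rightarrow> ('h, 'k) free_alg" where
  "free_eval \<theta> f = (\<Sum>w\<in>Poly_Mapping.keys f. Poly_Mapping.lookup f w \<cdot> word_prod \<theta> w)"

lemma word_prod_add: "word_prod \<theta> (u + v) = word_prod \<theta> u * word_prod \<theta> v"
  by (simp add: word_prod_def plus_word_def)

lemma free_eval_single: "free_eval \<theta> (Poly_Mapping.single w c) = c \<cdot> word_prod \<theta> w"
  by (cases "c = 0") (simp_all add: free_eval_def)

lemma free_eval_add: "free_eval \<theta> (f + g) = free_eval \<theta> f + free_eval \<theta> g"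
proof -
  \<comment> \<open>Supports may shrink under addition, so all three sums are taken over one finite
    set containing them; the extra terms vanish.\<close>
  have *: "free_eval \<theta> h = (\<Sum>w\<in>A. Poly_Mapping.lookup h w \<cdot> word_prod \<theta> w)"
    if "finite A" "Poly_Mapping.keys h \<subseteq> A" for h A
    unfolding free_eval_def using that
    by (intro sum.mono_neutral_left) (auto simp: in_keys_iff)
  let ?A = "Poly_Mapping.keys f \<union> Poly_Mapping.keys g"
  have "Poly_Mapping.keys (f + g) \<subseteq> ?A" by (rule Poly_Mapping.keys_add)
  then show ?thesis
    by (simp add: *[of ?A] lookup_add scal_add distrib_right sum.distrib)
qed

lemma free_eval_0 [simp]: "free_eval \<theta> 0 = 0"
  by (simp add: free_eval_def)

lemma free_eval_uminus: "free_eval \<theta> (- f) = - free_eval \<theta> f"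
  using free_eval_add[of \<theta> f "- f"] by (simp add: add_eq_0_iff)

lemma free_eval_diff: "free_eval \<theta> (f - g) = free_eval \<theta> f - free_eval \<theta> g"
  using free_eval_add[of \<theta> f "- g"] by (simp add: free_eval_uminus)

lemma free_eval_mult: "free_eval \<theta> (f * g) = free_eval \<theta> f * free_eval \<theta> g"
proof (induction f rule: free_alg_induct)
  case (single u c)
  show ?case
  proof (induction g rule: free_alg_induct)
    case (single v d)
    have "c \<cdot> word_prod \<theta> u * (d \<cdot> word_prod \<theta> v) = (c * d) \<cdot> (word_prod \<theta> u * word_prod \<theta> v)"
      by (simp add: scal_mult scale_left_commute[of "word_prod \<theta> u"] mult.assoc)
    then show ?case by (simp add: mult_single free_eval_single word_prod_add)
  qed (simp add: free_eval_add distrib_left)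
qed (simp add: free_eval_add distrib_right)

lemma free_eval_gen [simp]: "free_eval \<theta> (gen g) = \<theta> g"
  by (simp add: gen_def free_eval_single word_prod_def)

lemma free_eval_scal [simp]: "free_eval \<theta> (scal c) = scal c"
  by (subst scal_def) (simp add: free_eval_single word_prod_def zero_word_def)

lemma free_eval_1 [simp]: "free_eval \<theta> 1 = 1"
  using free_eval_scal[of \<theta> 1] by simp

lemmas free_eval_simps = free_eval_add free_eval_uminus free_eval_diff free_eval_mult

section \<open>The parity grading of the free algebra\<close>

lemma free_comp_0: "0 \<in> free_comp par p"
  by (simp add: free_comp_def)

lemma free_comp_add: "f \<in> free_comp par p \<Longrightarrow> g \<in> free_comp par p \<Longrightarrow> f + g \<in> free_comp par p"
  using Poly_Mapping.keys_add[of f g] by (auto simp: free_comp_def)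

lemma free_comp_uminus: "f \<in> free_comp par p \<Longrightarrow> - f \<in> free_comp par p"
  by (auto simp: free_comp_def in_keys_iff)

lemma free_comp_diff: "f \<in> free_comp par p \<Longrightarrow> g \<in> free_comp par p \<Longrightarrow> f - g \<in> free_comp par p"
  using free_comp_add[of f par p "- g"] free_comp_uminus[of g] by simp

lemma free_comp_mult:
  assumes "f \<in> free_comp par p" "g \<in> free_comp par p'"
  shows "f * g \<in> free_comp par (p + p')"
proof -
  have "(\<Sum>x\<leftarrow>letters w. par x) = p + p'" if "w \<in> Poly_Mapping.keys (f * g)" for w
  proof -
    obtain u v where "w = u + v" "u \<in> Poly_Mapping.keys f" "v \<in> Poly_Mapping.keys g"
      using \<open>w \<in> _\<close> keys_mult[of f g] by auto
    then show ?thesis using assms by (auto simp: free_comp_def plus_word_def)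
  qed
  then show ?thesis by (simp add: free_comp_def)
qed

lemma free_comp_scal: "scal c \<in> free_comp par 0"
  by (auto simp: free_comp_def scal_def zero_word_def)

lemma free_comp_scale: "f \<in> free_comp par p \<Longrightarrow> c \<cdot> f \<in> free_comp par p"
  using free_comp_mult[OF free_comp_scal, of f par p c] by (simp del: add_bit_eq_xor)

lemma free_comp_gen: "gen g \<in> free_comp par (par g)"
  by (auto simp: free_comp_def gen_def)

lemma free_eval_comp:
  assumes \<theta>: "\<And>g. \<theta> g \<in> free_comp par' (par g)" and f: "f \<in> free_comp par p"
  shows "free_eval \<theta> f \<in> free_comp par' p"
proof -
  have word: "word_prod \<theta> (Word gs) \<in> free_comp par' (\<Sum>g\<leftarrow>gs. par g)" for gs
  proof (induction gs)
    case Nil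
    show ?case using free_comp_scal[of 1] by (simp add: word_prod_def)
  next
    case (Cons g gs)
    then show ?case using free_comp_mult[OF \<theta>[of g]] by (simp add: word_prod_def)
  qed
  have "(\<Sum>w\<in>A. Poly_Mapping.lookup f w \<cdot> word_prod \<theta> w) \<in> free_comp par' p"
    if "finite A" "A \<subseteq> Poly_Mapping.keys f" for A
    using that
  proof (induction A rule: finite_induct)
    case (insert w A)
    have "word_prod \<theta> w \<in> free_comp par' p"
      using word[of "letters w"] f insert.prems by (auto simp: free_comp_def)
    then show ?case using insert by (simp add: free_comp_add free_comp_scale)
  qed (simp add: free_comp_0)
  then show ?thesis by (simp add: free_eval_def)
qed


section \<open>Presented algebras\<close>

lemma ring_of_type_algebra_ring: "ring (ring_of_type_algebra :: 'a::ring_1 ring)"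
proof -
  have "\<exists>y. x + y = 0" for x :: 'a
    using add.right_inverse by blast
  then show ?thesis
    unfolding ring_of_type_algebra_def using add.right_inverse
    by unfold_locales (auto simp: algebra_simps Units_def)
qed

section \<open>The relation ideal and the operations on its cosets\<close>

context
  fixes R :: "('g, 'k::field) free_alg set"
begin

lemma rel_ideal_ideal: "Ideal.ideal (rel_ideal R) ring_of_type_algebra"
  unfolding rel_ideal_def
  by (rule ring.genideal_ideal[OF ring_of_type_algebra_ring]) (simp add: ring_of_type_algebra_def)

interpretation ideal: Ideal.ideal "rel_ideal R" ring_of_type_algebra
  by (rule rel_ideal_ideal)

lemma rel_ideal_gen: "r \<in> R \<Longrightarrow> r \<in> rel_ideal R"
  unfolding rel_ideal_def
  using ring.genideal_self[OF ring_of_type_algebra_ring, of R]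
  by (auto simp: ring_of_type_algebra_def)

lemma rel_ideal_0: "0 \<in> rel_ideal R"
  using additive_subgroup.zero_closed[OF ideal.is_additive_subgroup] by (simp add: ring_of_type_algebra_def)

lemma rel_ideal_add: "f \<in> rel_ideal R \<Longrightarrow> g \<in> rel_ideal R \<Longrightarrow> f + g \<in> rel_ideal R"
  using additive_subgroup.a_closed[OF ideal.is_additive_subgroup] by (simp add: ring_of_type_algebra_def)

lemma rel_ideal_mult_left: "g \<in> rel_ideal R \<Longrightarrow> f * g \<in> rel_ideal R"
  using ideal.I_l_closed[of g f] by (simp add: ring_of_type_algebra_def)

lemma rel_ideal_mult_right: "g \<in> rel_ideal R \<Longrightarrow> g * f \<in> rel_ideal R"
  using ideal.I_r_closed[of g f] by (simp add: ring_of_type_algebra_def)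

lemma rel_ideal_uminus: "g \<in> rel_ideal R \<Longrightarrow> - g \<in> rel_ideal R"
  using rel_ideal_mult_left[of g "- 1"] by simp

lemma rel_ideal_diff: "f \<in> rel_ideal R \<Longrightarrow> g \<in> rel_ideal R \<Longrightarrow> f - g \<in> rel_ideal R"
  using rel_ideal_add[of f "- g"] rel_ideal_uminus[of g] by simp

text \<open>Negation is multiplication by \<open>- 1\<close>, so the closure conditions already make
  \<open>J\<close> an ideal, and \<open>genideal\<close> is the least ideal containing
  \<open>R\<close>.\<close>

lemma rel_ideal_minimal:
  assumes "R \<subseteq> J" "0 \<in> J" "\<And>f g. f \<in> J \<Longrightarrow> g \<in> J \<Longrightarrow> f + g \<in> J"
    and "\<And>f g. g \<in> J \<Longrightarrow> f * g \<in> J" "\<And>f g. g \<in> J \<Longrightarrow> g * f \<in> J"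
  shows "rel_ideal R \<subseteq> J"
proof -
  have "- g \<in> J" if "g \<in> J" for g using assms(4)[OF that, of "- 1"] by simp
  \<comment> \<open>This definite description is what the additive inverse of the record-based ring
    unfolds to.\<close>
  moreover have "(THE h. g + h = 0 \<and> h + g = 0) = - g" for g :: "('g, 'k) free_alg"
    by (rule the_equality) (auto dest: minus_unique)
  ultimately have "Ideal.ideal J ring_of_type_algebra"
    using assms ring_of_type_algebra_ring[where ?'a = "('g, 'k) free_alg"]
    by (intro idealI group.subgroupI abelian_group.a_group ring.is_abelian_group)
      (auto simp: ring_of_type_algebra_def a_inv_def m_inv_def)
  then show ?thesis
    unfolding rel_ideal_def
    by (rule ring.genideal_minimal[OF ring_of_type_algebra_ring]) (rule assms(1))
qed

lemma cls_eq_iff: "cls R f = cls R g \<longleftrightarrow> f - g \<in> rel_ideal R"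
proof -
  have mem: "h \<in> cls R f \<longleftrightarrow> h - f \<in> rel_ideal R" for h f
    by (auto simp: cls_def a_r_coset_def r_coset_def ring_of_type_algebra_def
      intro: bexI[of _ "h - f"])
  show ?thesis
  proof
    assume "cls R f = cls R g"
    then show "f - g \<in> rel_ideal R" using mem[of f f] mem[of f g] rel_ideal_0 by simp
  next
    assume fg: "f - g \<in> rel_ideal R"
    have "h - f \<in> rel_ideal R \<longleftrightarrow> h - g \<in> rel_ideal R" for h
      using rel_ideal_add[OF _ fg, of "h - f"] rel_ideal_diff[OF _ fg, of "h - g"] by auto
    then show "cls R f = cls R g" using mem by blast
  qed
qed

lemma carrier_presented: "carrier (presented par R) = range (cls R)"
  by (auto simp: presented_def Let_def FactRing_def A_RCOSETS_def RCOSETS_def cls_def a_r_coset_def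
    ring_of_type_algebra_def)

lemma presented_mult: "cls R f \<otimes>\<^bsub>presented par R\<^esub> cls R g = cls R (f * g)"
  using ideal.rcoset_mult_add[of f g]
  by (simp add: presented_def Let_def FactRing_def cls_def) (simp add: ring_of_type_algebra_def)

lemma presented_add: "cls R f \<oplus>\<^bsub>presented par R\<^esub> cls R g = cls R (f + g)"
  using ideal.a_rcos_sum[of f g]
  by (simp add: presented_def Let_def FactRing_def cls_def) (simp add: ring_of_type_algebra_def)

lemma presented_one: "\<one>\<^bsub>presented par R\<^esub> = cls R 1"
  by (simp add: presented_def Let_def FactRing_def cls_def) (simp add: ring_of_type_algebra_def)

lemma presented_smult: "c \<odot>\<^bsub>presented par R\<^esub> cls R f = cls R (c \<cdot> f)"
  using presented_mult[where f = "scal c" and g = f] by (simp add: presented_def Let_def)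

lemma presented_hcomp: "hcomp (presented par R) p = cls R ` free_comp par p"
  by (simp add: presented_def Let_def)

lemma presented_monoid: "Group.monoid (presented par R)"
  by (rule monoidI) (auto simp: carrier_presented presented_mult presented_one mult.assoc)

lemma presented_inv:
  assumes "cls R (f * g) = cls R 1" "cls R (g * f) = cls R 1"
  shows "inv\<^bsub>presented par R\<^esub> cls R f = cls R g"
  by (rule monoid.inv_unique'[OF presented_monoid, symmetric])
    (simp_all add: carrier_presented presented_mult presented_one assms)

end

text \<open>Universal property of a presentation: the elements that \<open>\<theta>\<close> sends
  into the target ideal form a two-sided ideal, so it is enough that this ideal contains the
  relations.\<close>

lemma ex_presented_hom:
  assumes rel: "\<And>r. r \<in> R \<Longrightarrow> free_eval \<theta> r \<in> rel_ideal R'"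
    and par: "\<And>g. \<theta> g \<in> free_comp par' (par g)"
  shows "\<exists>\<rho>. \<rho> \<in> extensional (carrier (presented par R)) \<and>
    \<rho> \<in> superalgebra_hom (presented par R) (presented par' R') \<and>
    (\<forall>f. \<rho> (cls R f) = cls R' (free_eval \<theta> f))"
proof -
  have "rel_ideal R \<subseteq> {f. free_eval \<theta> f \<in> rel_ideal R'}"
    by (rule rel_ideal_minimal)
      (auto simp: rel free_eval_simps rel_ideal_0 rel_ideal_add rel_ideal_mult_left rel_ideal_mult_right)
  then have wd: "cls R' (free_eval \<theta> f) = cls R' (free_eval \<theta> g)" if "cls R f = cls R g" for f g
    using that by (auto simp: cls_eq_iff free_eval_diff)
  \<comment> \<open>The value is read off from a chosen representative; \<open>wd\<close> makes the
    choice irrelevant.\<close>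
  define \<rho> where "\<rho> = (\<lambda>A\<in>range (cls R). cls R' (free_eval \<theta> (SOME f. A = cls R f)))"
  have \<rho>: "\<rho> (cls R f) = cls R' (free_eval \<theta> f)" for f
  proof -
    have "cls R (SOME g. cls R f = cls R g) = cls R f"
      by (rule someI2[of _ f]) simp_all
    from wd[OF this] show ?thesis by (simp add: \<rho>_def)
  qed
  have "\<rho> \<in> superalgebra_hom (presented par R) (presented par' R')"
    using free_eval_comp[of \<theta> par' par, OF par]
    by (auto simp: superalgebra_hom_def ring_hom_def carrier_presented presented_mult presented_add
      presented_one presented_smult presented_hcomp \<rho> free_eval_simps)
  moreover have "\<rho> \<in> extensional (carrier (presented par R))"
    by (simp add: \<rho>_def carrier_presented)
  ultimately show ?thesis using \<rho> by blast
qed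

text \<open>Multiplicativity carries agreement from generators to words, and linearity carries it to
  all classes; extensionality settles the arguments outside the carrier.\<close>

lemma presented_hom_eqI:
  fixes R :: "('g, 'k::field) free_alg set" and R' :: "('h, 'k) free_alg set"
  assumes "\<rho> \<in> superalgebra_hom (presented par R) (presented par' R')"
      "\<rho>' \<in> superalgebra_hom (presented par R) (presented par' R')"
    and "\<rho> \<in> extensional (carrier (presented par R))" "\<rho>' \<in> extensional (carrier (presented par R))"
    and gens: "\<And>g. \<rho> (cls R (gen g)) = \<rho>' (cls R (gen g))"
  shows "\<rho> = \<rho>'"
proof -
  have hom: "h (cls R 1) = \<one>\<^bsub>presented par' R'\<^esub>"
      "h (cls R (f * g)) = h (cls R f) \<otimes>\<^bsub>presented par' R'\<^esub> h (cls R g)"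
      "h (cls R (f + g)) = h (cls R f) \<oplus>\<^bsub>presented par' R'\<^esub> h (cls R g)"
    if "h \<in> superalgebra_hom (presented par R) (presented par' R')" for h f g
    unfolding presented_mult[where par = par, symmetric] presented_add[where par = par, symmetric]
      presented_one[where par = par, symmetric]
    using that by (auto simp: superalgebra_hom_def ring_hom_def carrier_presented)
  have hom_smult: "h (cls R (c \<cdot> f)) = c \<odot>\<^bsub>presented par' R'\<^esub> h (cls R f)"
    if "h \<in> superalgebra_hom (presented par R) (presented par' R')" for h c f
    unfolding presented_smult[where par = par, symmetric]
    using that by (auto simp: superalgebra_hom_def carrier_presented)
  have word: "\<rho> (cls R (Poly_Mapping.single (Word gs) 1)) = \<rho>' (cls R (Poly_Mapping.single (Word gs) 1))"
    for gs
  proof (induction gs)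
    case Nil
    show ?case using hom(1)[OF assms(1)] hom(1)[OF assms(2)] by (simp flip: zero_word_def)
  next
    case (Cons g gs)
    have "Poly_Mapping.single (Word (g # gs)) 1 = gen g * Poly_Mapping.single (Word gs) (1 :: 'k)"
      by (simp add: gen_def mult_single plus_word_def)
    then show ?case using Cons gens hom(2) assms(1,2) by metis
  qed
  have "\<rho> (cls R f) = \<rho>' (cls R f)" for f
  proof (induction f rule: free_alg_induct)
    case (single w c)
    have "Poly_Mapping.single w c = c \<cdot> Poly_Mapping.single (Word (letters w)) 1"
      by (simp add: scal_def mult_single)
    then show ?case using word hom_smult assms(1,2) by metis
  next
    case (add f g)
    then show ?case using hom(3) assms(1,2) by metis
  qed
  then show ?thesis
    using assms(3,4) by (intro extensionalityI[of _ "carrier (presented par R)"]) (auto simp: carrier_presented)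
qed

section \<open>Calculating modulo the relations\<close>

text \<open>A basis of \<open>S\<close> is extended to a basis of the whole space; \<open>P\<close>
  kills the former vectors and fixes the added ones.\<close>

lemma (in Vector_Spaces.vector_space) ex_projection_with_kernel:
  assumes S: "subspace S"
  shows "\<exists>P. Vector_Spaces.linear scale scale P \<and> (\<forall>v. P v = 0 \<longleftrightarrow> v \<in> S) \<and> (\<forall>v. P (P v) = P v)"
proof -
  interpret vector_space_pair scale scale ..
  obtain B where B: "B \<subseteq> S" "independent B" "S \<subseteq> span B"
    using maximal_independent_subset[of S] by blast
  define C where "C = extend_basis B"
  have C: "independent C" "span C = UNIV" "B \<subseteq> C"
    using B(2) by (auto simp: C_def independent_extend_basis span_extend_basis extend_basis_superset)
  define P where "P = construct C (\<lambda>b. if b \<in> B then 0 else b)"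
  have lin: "Vector_Spaces.linear scale scale P"
    unfolding P_def by (rule linear_construct) (rule C)
  have P_basis: "P b = (if b \<in> B then 0 else b)" if "b \<in> C" for b
    unfolding P_def by (rule construct_basis) (rule C, rule that)
  have "P v = 0" if "v \<in> span B" for v
    by (rule linear_eq_on[OF lin linear_zero that]) (use C P_basis in auto)
  moreover have "P v = v" if "v \<in> span (C - B)" for v
    by (rule linear_eq_on[OF lin linear_id that, simplified]) (use P_basis in auto)
  moreover have "\<exists>x\<in>span B. \<exists>y\<in>span (C - B). v = x + y" for v
  proof -
    have "v \<in> span (B \<union> (C - B))" using C by (simp add: Un_absorb1)
    then show ?thesis unfolding span_Un by auto
  qed
  moreover have "span B = S" using B S by (simp add: span_minimal subset_antisym)
  \<comment> \<open>Decomposing \<open>v = x + y\<close> along the two spans gives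
    \<open>P v = y\<close>, which yields both claims.\<close>
  ultimately have "P v = 0 \<longleftrightarrow> v \<in> S" "P (P v) = P v" for v
    using linear_add[OF lin] by (metis add_0 add.right_neutral)+
  with lin show ?thesis by blast
qed

interpretation free: Vector_Spaces.vector_space "\<lambda>c (f :: ('g, 'k::field) free_alg). c \<cdot> f"
  by standard (simp_all add: scal_add scal_mult algebra_simps)

text \<open>
  A complement of the relation ideal serves as a model of the quotient algebra that lives on a type:
  \<open>act R f\<close> is left multiplication by \<open>f\<close> on that model.
\<close>

definition normal_part :: "('g, 'k::field) free_alg set \<Rightarrow> ('g, 'k) free_alg \<Rightarrow> ('g, 'k) free_alg" where
  "normal_part R = (SOME P. Vector_Spaces.linear (\<lambda>c f. c \<cdot> f) (\<lambda>c f. c \<cdot> f) P \<and>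
     (\<forall>f. P f = 0 \<longleftrightarrow> f \<in> rel_ideal R) \<and> (\<forall>f. P (P f) = P f))"

definition act :: "('g, 'k::field) free_alg set \<Rightarrow> ('g, 'k) free_alg \<Rightarrow> ('g, 'k) free_alg \<Rightarrow> ('g, 'k) free_alg" where
  "act R f m = normal_part R (f * m)"

context
  fixes R :: "('g, 'k::field) free_alg set"
begin

private lemma normal_part:
  "Vector_Spaces.linear (\<lambda>c f. c \<cdot> f) (\<lambda>c f. c \<cdot> f) (normal_part R) \<and>
     (\<forall>f. normal_part R f = 0 \<longleftrightarrow> f \<in> rel_ideal R) \<and> (\<forall>f. normal_part R (normal_part R f) = normal_part R f)"
proof -
  have "free.subspace (rel_ideal R)"
    by (auto simp: free.subspace_def rel_ideal_0 rel_ideal_add rel_ideal_mult_left)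
  from someI_ex[OF free.ex_projection_with_kernel[OF this]] show ?thesis
    unfolding normal_part_def .
qed

lemma normal_part_0_iff: "normal_part R f = 0 \<longleftrightarrow> f \<in> rel_ideal R"
  using normal_part by blast

lemma normal_part_idem: "normal_part R (normal_part R f) = normal_part R f"
  using normal_part by blast

lemma normal_part_add: "normal_part R (f + g) = normal_part R f + normal_part R g"
  using normal_part by (simp add: Vector_Spaces.linear_iff)

lemma normal_part_scale: "normal_part R (c \<cdot> f) = c \<cdot> normal_part R f"
  using normal_part by (simp add: Vector_Spaces.linear_iff)

lemma normal_part_uminus: "normal_part R (- f) = - normal_part R f"
  using normal_part_scale[of "- 1" f] by (simp add: scal_uminus)

lemma normal_part_diff: "normal_part R (f - g) = normal_part R f - normal_part R g"
  using normal_part_add[of f "- g"] by (simp add: normal_part_uminus)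

text \<open>\<open>m\<close> and its normal part differ by an element of the ideal, which left
  multiplication preserves. This is what lets products act by composition in
  \<open>act_mult\<close>.\<close>

lemma act_normal_part: "act R f (normal_part R m) = act R f m"
proof -
  have "m - normal_part R m \<in> rel_ideal R"
    by (simp add: normal_part_0_iff[symmetric] normal_part_diff normal_part_idem)
  then have "f * (m - normal_part R m) \<in> rel_ideal R"
    by (rule rel_ideal_mult_left)
  then show ?thesis
    by (simp add: act_def normal_part_0_iff[symmetric] normal_part_diff right_diff_distrib)
qed

lemma normal_part_act: "normal_part R (act R f m) = act R f m"
  by (simp add: act_def normal_part_idem)

text \<open>Closure of the ideal under right multiplication makes a relation vanish at every
  argument, so relations turn into rewrite rules valid at any depth of a nested expression.\<close>

lemma act_rel: "r \<in> R \<Longrightarrow> act R r m = 0"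
  by (simp add: act_def normal_part_0_iff rel_ideal_gen rel_ideal_mult_right)

lemma act_mult: "act R (f * g) m = act R f (act R g m)"
  by (metis act_def act_normal_part mult.assoc)

lemma act_add_left: "act R (f + g) m = act R f m + act R g m"
  by (simp add: act_def distrib_right normal_part_add)

lemma act_uminus_left: "act R (- f) m = - act R f m"
  by (simp add: act_def normal_part_uminus)

lemma act_diff_left: "act R (f - g) m = act R f m - act R g m"
  by (simp add: act_def left_diff_distrib normal_part_diff)

lemma act_scale_left: "act R (c \<cdot> f) m = c \<cdot> act R f m"
  by (simp add: act_def mult.assoc normal_part_scale)

lemma act_one: "act R 1 m = normal_part R m"
  by (simp add: act_def)

lemma act_zero_left: "act R 0 m = 0"
  by (simp add: act_def normal_part_0_iff rel_ideal_0)

lemma act_scal: "act R (scal c) m = c \<cdot> normal_part R m"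
  by (simp add: act_def normal_part_scale)

lemma act_add_right: "act R f (m + n) = act R f m + act R f n"
  by (simp add: act_def distrib_left normal_part_add)

lemma act_zero_right: "act R f 0 = 0"
  by (simp add: act_def normal_part_0_iff rel_ideal_0)

lemma act_uminus_right: "act R f (- m) = - act R f m"
  by (simp add: act_def normal_part_uminus)

lemma act_diff_right: "act R f (m - n) = act R f m - act R f n"
  by (simp add: act_def right_diff_distrib normal_part_diff)

lemma act_scale_right: "act R f (c \<cdot> m) = c \<cdot> act R f m"
  by (simp add: act_def scale_left_commute[of f] normal_part_scale)

lemmas act_simps = act_mult act_scale_left act_add_left act_uminus_left act_diff_left act_one act_scal
  act_zero_left act_zero_right act_add_right act_uminus_right act_diff_right act_scale_right
  act_normal_part normal_part_act normal_part_idem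

text \<open>\<open>act R f 1\<close> is the normal part of \<open>f\<close>, so comparing the
  operators at \<open>1\<close> is enough.\<close>

lemma cls_eqI:
  assumes "act R f 1 = act R g 1"
  shows "cls R f = cls R g"
proof -
  have "normal_part R (f - g) = 0"
    using assms by (simp add: act_def normal_part_diff)
  then show ?thesis by (simp add: cls_eq_iff normal_part_0_iff)
qed

lemma act_cong:
  assumes "cls R f = cls R g"
  shows "act R f m = act R g m"
proof -
  have "(f - g) * m \<in> rel_ideal R"
    using assms by (simp add: cls_eq_iff rel_ideal_mult_right)
  then show ?thesis
    by (simp add: act_def normal_part_0_iff[symmetric] normal_part_diff left_diff_distrib)
qed

end

section \<open>Normal forms in \<open>W\<close>\<close>

context
  fixes q :: "'k::field"
  assumes q_nz: "q \<noteq> 0" and qq: "q * q \<noteq> 1"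
begin

private abbreviation op where "op \<equiv> act (W_rels q)"
private abbreviation nrm where "nrm \<equiv> normal_part (W_rels q)"

lemma gen_free_sub: "g \<in> S \<Longrightarrow> gen g \<in> free_sub S"
  by (simp add: gen_def free_sub_def)

lemma op_comm: "op f (op g m) = op g (op f m)" if "f * g - g * f \<in> W_rels q"
  using act_rel[OF that] by (simp add: act_diff_left act_mult)

lemma op_inv: "op f (op g m) = nrm m" if "f * g - 1 \<in> W_rels q"
  using act_rel[OF that] by (simp add: act_simps)

section \<open>Exchange of generators from different families\<close>

lemma op_b_H:
  assumes "b \<in> b_gens" "h \<in> H_gens"
  shows "op (gen b) (op (gen h) m) = op (gen h) (op (gen b) m)"
proof (rule op_comm[symmetric])
  show "gen h * gen b - gen b * gen h \<in> W_rels q"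
    using assms gen_free_sub[of h H_gens] unfolding W_rels_def mixed_rels_def by blast
qed

lemma op_gl11_H:
  assumes "y \<in> gl11_gens" "h \<in> H_gens"
  shows "op (gen y) (op (gen h) m) = op (gen h) (op (gen y) m)"
proof (rule op_comm[symmetric])
  show "gen h * gen y - gen y * gen h \<in> W_rels q"
    using assms gen_free_sub[of h H_gens] gen_free_sub[of y gl11_gens]
    unfolding W_rels_def mixed_rels_def by blast
qed

lemma op_gl11_b:
  assumes "y \<in> gl11_gens" "b \<in> b_gens"
  shows "op (gen y) (op (gen b) m) = (if wpar y = 0 then 1 else - 1) \<cdot> op (gen b) (op (gen y) m)"
proof -
  have "gen y * gen b - (if wpar y = 0 then 1 else - 1) \<cdot> (gen b * gen y) \<in> W_rels q"
    using assms free_comp_gen[of y wpar] gen_free_sub[of y gl11_gens]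
    unfolding W_rels_def mixed_rels_def by blast
  from act_rel[OF this] show ?thesis by (simp add: act_simps)
qed

lemma gens_mem:
  "Aplus \<in> H_gens" "Aminus \<in> H_gens" "Qx \<in> H_gens" "Qxinv \<in> H_gens" "Bplus \<in> b_gens" "Bminus \<in> b_gens"
  "Gk2 \<in> gl11_gens" "Gk2inv \<in> gl11_gens" "Gk3 \<in> gl11_gens" "Gk3inv \<in> gl11_gens"
  "Ge23 \<in> gl11_gens" "Ge32 \<in> gl11_gens"
  by (simp_all add: H_gens_def b_gens_def gl11_gens_def)

text \<open>Subtracting the two deformed commutation relations solves for \<open>ap * am\<close>,
  and then for \<open>am * ap\<close>; the division by \<open>q - inverse q\<close> uses
  \<open>q * q \<noteq> 1\<close>. Hence \<open>ap\<close> and \<open>am\<close> are never adjacent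
  in an ordered monomial, and powers of \<open>qx\<close> stand to their right.\<close>

lemma op_H:
  "op qx (op qxi m) = nrm m" "op qxi (op qx m) = nrm m"
  "op qx (op ap m) = q \<cdot> op ap (op qx m)" "op qx (op am m) = inverse q \<cdot> op am (op qx m)"
  "op qxi (op ap m) = inverse q \<cdot> op ap (op qxi m)" "op qxi (op am m) = q \<cdot> op am (op qxi m)"
  "op ap (op am m) = inverse (q - inverse q) \<cdot> (op qx m - op qxi m)"
  "op am (op ap m) = inverse (q - inverse q) \<cdot> (q \<cdot> op qx m - inverse q \<cdot> op qxi m)"
proof -
  have H: "r \<in> H_rels q \<Longrightarrow> op r m = 0" for r m
    by (rule act_rel) (simp add: W_rels_def)
  show i1: "op qx (op qxi m) = nrm m" and i2: "op qxi (op qx m) = nrm m" for m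
    using H[of "qx * qxi - 1" m] H[of "qxi * qx - 1" m] by (simp_all add: H_rels_def act_simps)
  \<comment> \<open>Evaluated at \<open>op qx m\<close>, the conjugation relations lose their
    trailing \<open>qxi\<close> and become exchange rules.\<close>
  show p1: "op qx (op ap m) = q \<cdot> op ap (op qx m)"
    and a1: "op qx (op am m) = inverse q \<cdot> op am (op qx m)" for m
    using H[of "qx * ap * qxi - q \<cdot> ap" "op qx m"] H[of "qx * am * qxi - inverse q \<cdot> am" "op qx m"]
    by (simp_all add: H_rels_def act_simps i2)
  \<comment> \<open>Inserting \<open>qx * qxi\<close> converts an exchange rule for
    \<open>qx\<close> into one for \<open>qxi\<close> with the inverse factor.\<close>
  have inv_scale: "op qxi (op x m) = inverse c \<cdot> op x (op qxi m)"
    if "\<And>m. op qx (op x m) = c \<cdot> op x (op qx m)" "c \<noteq> 0" for c x m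
  proof -
    have "op x m = op x (op qx (op qxi m))" by (simp add: i1 act_simps)
    also have "\<dots> = inverse c \<cdot> (c \<cdot> op x (op qx (op qxi m)))"
      using that(2) by (simp flip: scal_mult mult.assoc)
    also have "\<dots> = inverse c \<cdot> op qx (op x (op qxi m))" by (simp add: that(1))
    finally have "op qxi (op x m) = op qxi (inverse c \<cdot> op qx (op x (op qxi m)))" by simp
    then show ?thesis by (simp add: act_simps i2)
  qed
  show "op qxi (op ap m) = inverse q \<cdot> op ap (op qxi m)" "op qxi (op am m) = q \<cdot> op am (op qxi m)"
    using inv_scale[of ap q, OF p1 q_nz] inv_scale[of am "inverse q", OF a1] q_nz by simp_all
  have d: "q - inverse q \<noteq> 0" using q_nz qq by (simp add: field_simps)
  have m1: "op am (op ap m) = inverse q \<cdot> op ap (op am m) + op qx m"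
    and m2: "op am (op ap m) = q \<cdot> op ap (op am m) + op qxi m"
    using H[of "am * ap - inverse q \<cdot> (ap * am) - qx" m] H[of "am * ap - q \<cdot> (ap * am) - qxi" m]
    by (simp_all add: H_rels_def act_simps algebra_simps)
  have "(q - inverse q) \<cdot> op ap (op am m) = op qx m - op qxi m"
    using m1 m2 by (simp add: scal_diff algebra_simps)
  then have "inverse (q - inverse q) \<cdot> ((q - inverse q) \<cdot> op ap (op am m))
    = inverse (q - inverse q) \<cdot> (op qx m - op qxi m)" by simp
  then show apam: "op ap (op am m) = inverse (q - inverse q) \<cdot> (op qx m - op qxi m)"
    using d by (simp flip: scal_mult mult.assoc)
  show "op am (op ap m) = inverse (q - inverse q) \<cdot> (q \<cdot> op qx m - inverse q \<cdot> op qxi m)"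
    unfolding m1 apam using q_nz qq
    by (intro poly_mapping_eqI) (simp add: lookup_scale lookup_add lookup_minus field_simps)
qed

lemma op_b:
  "op bm (op bm m) = 0" "op bp (op bp m) = 0" "op bm (op bp m) = nrm m - op bp (op bm m)"
proof -
  have B: "r \<in> b_rels \<Longrightarrow> op r m = 0" for r
    by (rule act_rel) (simp add: W_rels_def)
  show "op bm (op bm m) = 0" "op bp (op bp m) = 0" "op bm (op bp m) = nrm m - op bp (op bm m)"
    using B[of "bm * bm"] B[of "bp * bp"] B[of "bm * bp + bp * bm - 1"]
    by (simp_all add: b_rels_def act_simps algebra_simps)
qed

section \<open>Ordering rules inside Uq(gl(1/1))\<close>

lemma op_k_commute:
  assumes "g \<in> {Gk2, Gk2inv, Gk3, Gk3inv}" "h \<in> {Gk2, Gk2inv, Gk3, Gk3inv}"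
  shows "op (gen g) (op (gen h) m) = op (gen h) (op (gen g) m)"
  by (rule op_comm) (use assms in \<open>unfold W_rels_def gl11_rels_def, blast\<close>)

lemma op_k_inv:
  "op k2 (op k2i m) = nrm m" "op k2i (op k2 m) = nrm m"
  "op k3 (op k3i m) = nrm m" "op k3i (op k3 m) = nrm m"
proof -
  show 1: "op k2 (op k2i m) = nrm m" and 2: "op k3 (op k3i m) = nrm m"
    by (rule op_inv, simp add: W_rels_def gl11_rels_def)+
  show "op k2i (op k2 m) = nrm m" "op k3i (op k3 m) = nrm m"
    using 1 2 op_k_commute[of Gk2 Gk2inv m] op_k_commute[of Gk3 Gk3inv m] by simp_all
qed

lemma op_k_e:
  assumes "(g, i) \<in> {(Gk2, I2), (Gk3, I3)}" "(e, j, l) \<in> {(Ge23, I2, I3), (Ge32, I3, I2)}"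
  shows "op (gen g) (op (gen e) m)
    = q powi (of_bool (i = j) - of_bool (i = l)) \<cdot> op (gen e) (op (gen g) m)"
proof -
  have "gen g * gen e - q powi (of_bool (i = j) - of_bool (i = l)) \<cdot> (gen e * gen g) \<in> W_rels q"
    unfolding W_rels_def gl11_rels_def using assms by blast
  from act_rel[OF this] show ?thesis by (simp add: act_simps)
qed

text \<open>The weight relations are solved so that each \<open>k\<close> moves to the left of each
  \<open>e\<close>. They are imposed for \<open>k2\<close> and \<open>k3\<close> only; the rules for
  \<open>k2i\<close> and \<open>k3i\<close> follow by inserting a \<open>k\<close> next to its
  inverse.\<close>

lemma op_e_k:
  "op e23 (op k2 m) = inverse q \<cdot> op k2 (op e23 m)" "op e23 (op k3 m) = q \<cdot> op k3 (op e23 m)"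
  "op e32 (op k2 m) = q \<cdot> op k2 (op e32 m)" "op e32 (op k3 m) = inverse q \<cdot> op k3 (op e32 m)"
  "op e23 (op k2i m) = q \<cdot> op k2i (op e23 m)" "op e23 (op k3i m) = inverse q \<cdot> op k3i (op e23 m)"
  "op e32 (op k2i m) = inverse q \<cdot> op k2i (op e32 m)" "op e32 (op k3i m) = q \<cdot> op k3i (op e32 m)"
proof -
  have swap: "op x (op y m) = inverse c \<cdot> op y (op x m)"
    if "op y (op x m) = c \<cdot> op x (op y m)" "c \<noteq> 0" for x y c m
    using that by (simp flip: scal_mult mult.assoc)
  show k: "op e23 (op k2 m) = inverse q \<cdot> op k2 (op e23 m)" "op e23 (op k3 m) = q \<cdot> op k3 (op e23 m)"
    "op e32 (op k2 m) = q \<cdot> op k2 (op e32 m)" "op e32 (op k3 m) = inverse q \<cdot> op k3 (op e32 m)" for m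
    using swap[OF op_k_e[of Gk2 I2 Ge23 I2 I3 m]] swap[OF op_k_e[of Gk3 I3 Ge23 I2 I3 m]]
      swap[OF op_k_e[of Gk2 I2 Ge32 I3 I2 m]] swap[OF op_k_e[of Gk3 I3 Ge32 I3 I2 m]] q_nz
    by simp_all
  have inv: "op e (op k' m) = inverse c \<cdot> op k' (op e m)"
    if k: "\<And>m. op e (op k m) = c \<cdot> op k (op e m)" and "c \<noteq> 0"
      and kk': "\<And>m. op k (op k' m) = nrm m" and k'k: "\<And>m. op k' (op k m) = nrm m" for e k k' c m
  proof -
    have "op k' (op e m) = op k' (op e (op k (op k' m)))" by (simp add: kk' act_simps)
    also have "\<dots> = c \<cdot> op e (op k' m)" by (simp add: k act_simps k'k)
    finally show ?thesis using \<open>c \<noteq> 0\<close> by (simp flip: scal_mult mult.assoc)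
  qed
  show "op e23 (op k2i m) = q \<cdot> op k2i (op e23 m)" "op e23 (op k3i m) = inverse q \<cdot> op k3i (op e23 m)"
    "op e32 (op k2i m) = inverse q \<cdot> op k2i (op e32 m)" "op e32 (op k3i m) = q \<cdot> op k3i (op e32 m)"
    using inv[of e23 k2, OF k(1) _ op_k_inv(1,2)] inv[of e23 k3, OF k(2) _ op_k_inv(3,4)]
      inv[of e32 k2, OF k(3) _ op_k_inv(1,2)] inv[of e32 k3, OF k(4) _ op_k_inv(3,4)] q_nz
    by simp_all
qed

lemma op_e:
  "op e23 (op e23 m) = 0" "op e32 (op e32 m) = 0"
  "op e32 (op e23 m) = inverse (q - inverse q) \<cdot> (op k2 (op k3 m) - op k2i (op k3i m)) - op e23 (op e32 m)"
proof -
  have G: "r \<in> gl11_rels q \<Longrightarrow> op r m = 0" for r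
    by (rule act_rel) (simp add: W_rels_def)
  show "op e23 (op e23 m) = 0" "op e32 (op e32 m) = 0"
  "op e32 (op e23 m) = inverse (q - inverse q) \<cdot> (op k2 (op k3 m) - op k2i (op k3i m)) - op e23 (op e32 m)"
    using G[of "e23 * e23"] G[of "e32 * e32"]
      G[of "(e23 * e32 + e32 * e23) - inverse (q - inverse q) \<cdot> (k2 * k3 - k2i * k3i)"]
    by (simp_all add: gl11_rels_def act_simps algebra_simps)
qed

text \<open>\<open>op_k_commute\<close> is symmetric, so only instances oriented with the index 2
  first are used for rewriting.\<close>

lemmas op_k_order =
  op_k_commute[of Gk3 Gk2, simplified] op_k_commute[of Gk3 Gk2inv, simplified]
  op_k_commute[of Gk3inv Gk2, simplified] op_k_commute[of Gk3inv Gk2inv, simplified]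

text \<open>The resulting order is \<open>ap\<close> or \<open>am\<close>, then \<open>qx\<close>,
  \<open>bp\<close>, \<open>bm\<close>, \<open>k2\<close>, \<open>k3\<close>, \<open>e23\<close>,
  \<open>e32\<close>, where \<open>qx\<close>, \<open>k2\<close>, \<open>k3\<close> may be replaced
  by their inverses.\<close>

lemmas op_order = op_H op_b op_k_inv op_k_order op_e_k op_e
  gens_mem(1-4)[THEN op_b_H[OF gens_mem(5)]] gens_mem(1-4)[THEN op_b_H[OF gens_mem(6)]]
  gens_mem(1-4)[THEN op_gl11_H[OF gens_mem(7)]] gens_mem(1-4)[THEN op_gl11_H[OF gens_mem(8)]]
  gens_mem(1-4)[THEN op_gl11_H[OF gens_mem(9)]] gens_mem(1-4)[THEN op_gl11_H[OF gens_mem(10)]]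
  gens_mem(1-4)[THEN op_gl11_H[OF gens_mem(11)]] gens_mem(1-4)[THEN op_gl11_H[OF gens_mem(12)]]
  gens_mem(5)[THEN op_gl11_b[OF gens_mem(7)], simplified] gens_mem(6)[THEN op_gl11_b[OF gens_mem(7)], simplified]
  gens_mem(5)[THEN op_gl11_b[OF gens_mem(8)], simplified] gens_mem(6)[THEN op_gl11_b[OF gens_mem(8)], simplified]
  gens_mem(5)[THEN op_gl11_b[OF gens_mem(9)], simplified] gens_mem(6)[THEN op_gl11_b[OF gens_mem(9)], simplified]
  gens_mem(5)[THEN op_gl11_b[OF gens_mem(10)], simplified] gens_mem(6)[THEN op_gl11_b[OF gens_mem(10)], simplified]
  gens_mem(5)[THEN op_gl11_b[OF gens_mem(11)], simplified] gens_mem(6)[THEN op_gl11_b[OF gens_mem(11)], simplified]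
  gens_mem(5)[THEN op_gl11_b[OF gens_mem(12)], simplified] gens_mem(6)[THEN op_gl11_b[OF gens_mem(12)], simplified]

end

section \<open>The realization\<close>

text \<open>\<open>L\<close> is the scalar q^lambda_1. Modulo the relations \<open>bm * bp\<close>
  and \<open>bp * bm\<close> are orthogonal idempotents with sum 1, so inverting the coefficient of
  \<open>bp * bm\<close> inverts such a combination; this gives the values at
  \<open>Kinv\<close>.\<close>

fun realization :: "'k::field \<Rightarrow> 'k \<Rightarrow> ugen \<Rightarrow> (wgen, 'k) free_alg" where
  "realization q L (K I1) = (L \<cdot> qx) * (bm * bp + q \<cdot> (bp * bm))"
| "realization q L (K I2) = qxi * k2"
| "realization q L (K I3) = (bm * bp + inverse q \<cdot> (bp * bm)) * k3"
| "realization q L (Kinv I1) = (inverse L \<cdot> qxi) * (bm * bp + inverse q \<cdot> (bp * bm))"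
| "realization q L (Kinv I2) = qx * k2i"
| "realization q L (Kinv I3) = (bm * bp + q \<cdot> (bp * bm)) * k3i"
| "realization q L E12 = ap"
| "realization q L E23 = - (q \<cdot> (am * bp)) + qx * (bm * bp + q \<cdot> (bp * bm)) * e23"
| "realization q L E32 = inverse q \<cdot> (ap * bm * k2 * k3) + e32"
| "realization q L E21 =
    - (inverse (q - inverse q) \<cdot> am
       * ((L * inverse q) \<cdot> qx * (bm * bp + q \<cdot> (bp * bm)) * k2i
          - (inverse L * q) \<cdot> qxi * (bm * bp + inverse q \<cdot> (bp * bm)) * k2))
    - inverse L \<cdot> (bm * e23 * k2)"

text \<open>Passing to coefficients turns each \<open>scal c\<close> into a factor in the field, so
  an identity between ordered monomials becomes commutative arithmetic.\<close>

lemma wcls_eqI: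
  assumes "\<And>w. Poly_Mapping.lookup (act (W_rels q) f 1) w = Poly_Mapping.lookup (act (W_rels q) g 1) w"
  shows "wcls q f = wcls q g"
  unfolding wcls_def by (rule cls_eqI, rule poly_mapping_eqI, rule assms)

text \<open>
  The coefficients are kept in a normal form in which \<open>p\<close>, \<open>M\<close>, \<open>d\<close> stand for the inverses of \<open>q\<close>, \<open>L\<close>,
  \<open>q - p\<close>.  The one-letter names matter: the simplifier sorts products by variable name, and the
  rewrite rules \<open>coeff_simps\<close> need \<open>L\<close>, \<open>M\<close> as well as \<open>d\<close>, \<open>p\<close>, \<open>q\<close> to become neighbours.
\<close>

context
  fixes q L p M d :: "'k::field"
  assumes q_nz: "q \<noteq> 0" and qq: "q * q \<noteq> 1" and L_nz: "L \<noteq> 0"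
    and coeffs: "inverse q = p" "inverse L = M" "inverse (q - p) = d"
begin

private abbreviation (input) "\<theta> \<equiv> realization q L"

private lemmas W_simps = act_simps op_order[OF q_nz qq] lookup_scale lookup_add lookup_minus lookup_uminus
  lookup_zero realization.simps coeffs

private lemma coeff_simps:
  "p * q = 1" "p * (q * x) = x" "L * M = 1" "L * (M * x) = x"
  "d * q = 1 + d * p" "d * (q * x) = x + d * (p * x)"
  "d * (p * p) = d - p" "d * (p * (p * x)) = d * x - p * x"
  "q powi - 2 = p * p"
proof -
  show p: "p * q = 1" and M: "L * M = 1" using q_nz L_nz by (auto simp flip: coeffs)
  then show "p * (q * x) = x" "L * (M * x) = x" by (simp_all flip: mult.assoc)
  have "q - p \<noteq> 0" using p qq by auto
  then have "d * (q - p) = 1" by (simp flip: coeffs(3))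
  then show d: "d * q = 1 + d * p" by (simp add: algebra_simps)
  then have "d * q * x = (1 + d * p) * x" by simp
  then show "d * (q * x) = x + d * (p * x)" by (simp add: algebra_simps)
  \<comment> \<open>Inserting \<open>p * q = 1\<close> turns the rule for \<open>d * q\<close> into
    one for \<open>d * (p * p)\<close>; together they leave at most one \<open>p\<close> and no
    \<open>q\<close> beside \<open>d\<close>.\<close>
  have "d = d * (p * q)" using p by simp
  also have "\<dots> = d * q * p" by (simp only: ac_simps)
  finally show dp: "d * (p * p) = d - p" unfolding d by (simp add: algebra_simps)
  then have "d * (p * p) * x = (d - p) * x" by simp
  then show "d * (p * (p * x)) = d * x - p * x" by (simp add: algebra_simps)
  show "q powi - 2 = p * p" by (simp add: power_int_def power2_eq_square coeffs)
qed

section \<open>Verification of the defining relations\<close>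

lemma realization_K_Kinv:
  "wcls q (\<theta> (K i) * \<theta> (Kinv i)) = wcls q 1" "wcls q (\<theta> (Kinv i) * \<theta> (K i)) = wcls q 1"
  \<comment> \<open>The first simplification orders the generators and takes coefficients, the
    second compares these in the field; the other relations follow the same pattern.\<close>
  by (cases i; rule wcls_eqI; simp only: W_simps; simp add: algebra_simps coeff_simps)+

lemma realization_torus_commute:
  assumes "g \<in> range K \<union> range Kinv" "h \<in> range K \<union> range Kinv"
  shows "wcls q (\<theta> g * \<theta> h) = wcls q (\<theta> h * \<theta> g)"
proof -
  have KK: "wcls q (\<theta> (K i) * \<theta> (K j)) = wcls q (\<theta> (K j) * \<theta> (K i))"
    and KI: "wcls q (\<theta> (K i) * \<theta> (Kinv j)) = wcls q (\<theta> (Kinv j) * \<theta> (K i))"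
    and II: "wcls q (\<theta> (Kinv i) * \<theta> (Kinv j)) = wcls q (\<theta> (Kinv j) * \<theta> (Kinv i))" for i j
    by (cases i; cases j; rule wcls_eqI; simp only: W_simps; simp add: algebra_simps coeff_simps)+
  show ?thesis using assms KK KI KI[symmetric] II by blast
qed

lemma realization_K_E:
  assumes "(e, j, k) \<in> {(E12, I1, I2), (E21, I2, I1), (E23, I2, I3), (E32, I3, I2)}"
  shows "wcls q (\<theta> (K i) * \<theta> e)
    = wcls q (q powi (of_bool (i = j) - of_bool (i = k)) \<cdot> (\<theta> e * \<theta> (K i)))"
proof -
  \<comment> \<open>The restricted simplification needs explicit rules for the exponent, which is 0,
    1 or -1 in every case.\<close>
  note powi = ix.distinct of_bool_eq refl power_int_0_right power_int_1_right power_int_minus1_right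
    diff_0 diff_0_right diff_self
  have "wcls q (\<theta> (K i) * \<theta> E12)
      = wcls q (q powi (of_bool (i = I1) - of_bool (i = I2)) \<cdot> (\<theta> E12 * \<theta> (K i)))"
    "wcls q (\<theta> (K i) * \<theta> E21)
      = wcls q (q powi (of_bool (i = I2) - of_bool (i = I1)) \<cdot> (\<theta> E21 * \<theta> (K i)))"
    "wcls q (\<theta> (K i) * \<theta> E23)
      = wcls q (q powi (of_bool (i = I2) - of_bool (i = I3)) \<cdot> (\<theta> E23 * \<theta> (K i)))"
    "wcls q (\<theta> (K i) * \<theta> E32)
      = wcls q (q powi (of_bool (i = I3) - of_bool (i = I2)) \<cdot> (\<theta> E32 * \<theta> (K i)))"
    by (cases i; rule wcls_eqI; simp only: powi W_simps; simp add: algebra_simps coeff_simps)+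
  then show ?thesis using assms by auto
qed

text \<open>The \<open>e23\<close> terms cancel because \<open>qx * ap\<close> equals
  \<open>q\<close> times \<open>ap * qx\<close>. What remains is \<open>bp\<close> times the
  difference of \<open>am * ap\<close> and \<open>q \<cdot> (ap * am)\<close>, which is
  \<open>qxi\<close>.\<close>

lemma realization_E13: "wcls q (free_eval \<theta> (elem13 q)) = wcls q (qxi * bp)"
proof -
  have "wcls q (\<theta> E12 * \<theta> E23 - inverse q \<cdot> (\<theta> E23 * \<theta> E12)) = wcls q (qxi * bp)"
    by (rule wcls_eqI) (simp only: W_simps, simp add: algebra_simps coeff_simps)
  then show ?thesis by (simp add: elem13_def free_eval_simps)
qed

text \<open>Besides being one of the asserted formulae, this closed form replaces
  \<open>elem31 q\<close> in the Serre relation.\<close>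

lemma realization_E31:
  "wcls q (free_eval \<theta> (elem31 q)) =
    wcls q (ap * am * bm * ((L * inverse q) \<cdot> qx) * k3
            + am * ((L * q powi (-2)) \<cdot> qx) * (bm * bp + q \<cdot> (bp * bm)) * k2i * e32
            + inverse q \<cdot> bm * (inverse (q - inverse q) \<cdot> (L \<cdot> k3 - inverse L \<cdot> k3i)))"
    (is "_ = wcls q ?E31")
proof -
  have "wcls q (- (\<theta> E21 * \<theta> E32) + inverse q \<cdot> (\<theta> E32 * \<theta> E21)) = wcls q ?E31"
    by (rule wcls_eqI) (simp only: W_simps, simp add: algebra_simps coeff_simps)
  then show ?thesis by (simp add: elem31_def free_eval_simps)
qed

lemma realization_E_rels:
  "wcls q (\<theta> E12 * \<theta> E32) = wcls q (\<theta> E32 * \<theta> E12)"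
  "wcls q (\<theta> E21 * \<theta> E23) = wcls q (\<theta> E23 * \<theta> E21)"
  "wcls q (\<theta> E12 * \<theta> E21 - \<theta> E21 * \<theta> E12)
    = wcls q (inverse (q - inverse q) \<cdot> (\<theta> (K I1) * \<theta> (Kinv I2) - \<theta> (Kinv I1) * \<theta> (K I2)))"
  "wcls q (\<theta> E23 * \<theta> E32 + \<theta> E32 * \<theta> E23)
    = wcls q (inverse (q - inverse q) \<cdot> (\<theta> (K I2) * \<theta> (K I3) - \<theta> (Kinv I2) * \<theta> (Kinv I3)))"
  "wcls q (\<theta> E23 * \<theta> E23) = wcls q 0"
  "wcls q (\<theta> E32 * \<theta> E32) = wcls q 0"
  by (rule wcls_eqI; simp only: W_simps; simp add: algebra_simps coeff_simps)+

text \<open>\<open>act_cong\<close> inserts the closed forms of \<open>elem13 q\<close> and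
  \<open>elem31 q\<close> before anything is expanded. The first relation then reduces to exchanging
  \<open>ap\<close> and \<open>qxi\<close>.\<close>

lemma realization_Serre:
  "wcls q (\<theta> E12 * free_eval \<theta> (elem13 q)) = wcls q (q \<cdot> (free_eval \<theta> (elem13 q) * \<theta> E12))"
  "wcls q (\<theta> E21 * free_eval \<theta> (elem31 q)) = wcls q (q \<cdot> (free_eval \<theta> (elem31 q) * \<theta> E21))"
  by (rule wcls_eqI;
      simp only: act_mult act_scale_left act_cong[OF realization_E13[unfolded wcls_def]] act_cong[OF realization_E31[unfolded wcls_def]];
      simp only: W_simps; simp add: algebra_simps coeff_simps)+

lemma realization_rels:
  assumes "r \<in> gl21_rels q"
  shows "free_eval \<theta> r \<in> rel_ideal (W_rels q)"
proof -
  have I: "f - g \<in> rel_ideal (W_rels q)" if "wcls q f = wcls q g" for f g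
    using that by (simp add: wcls_def cls_eq_iff)
  from assms consider
    (torus) g h where "r = gen g * gen h - gen h * gen g" "g \<in> range K \<union> range Kinv" "h \<in> range K \<union> range Kinv"
  | (inv) i where "r = gen (K i) * gen (Kinv i) - 1"
  | (weight) i e j k where
      "r = gen (K i) * gen e - q powi (of_bool (i = j) - of_bool (i = k)) \<cdot> (gen e * gen (K i))"
      "(e, j, k) \<in> {(E12, I1, I2), (E21, I2, I1), (E23, I2, I3), (E32, I3, I2)}"
  | (E) "r \<in> {gen E12 * gen E32 - gen E32 * gen E12,
      gen E21 * gen E23 - gen E23 * gen E21,
      (gen E12 * gen E21 - gen E21 * gen E12)
        - inverse (q - inverse q) \<cdot> (gen (K I1) * gen (Kinv I2) - gen (Kinv I1) * gen (K I2)),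
      (gen E23 * gen E32 + gen E32 * gen E23)
        - inverse (q - inverse q) \<cdot> (gen (K I2) * gen (K I3) - gen (Kinv I2) * gen (Kinv I3)),
      gen E23 * gen E23,
      gen E32 * gen E32,
      gen E12 * elem13 q - q \<cdot> (elem13 q * gen E12),
      gen E21 * elem31 q - q \<cdot> (elem31 q * gen E21)}"
    unfolding gl21_rels_def by blast
  then show ?thesis
  proof cases
    case torus
    then show ?thesis
      using I[OF realization_torus_commute] by (simp only: free_eval_simps free_eval_gen)
  next
    case inv
    then show ?thesis
      using I[OF realization_K_Kinv(1)] by (simp only: free_eval_simps free_eval_gen free_eval_1)
  next
    case weight
    then show ?thesis
      using I[OF realization_K_E] by (simp only: free_eval_simps free_eval_gen free_eval_scal)
  next
    case E
    then show ?thesis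
      using realization_E_rels[THEN I] realization_Serre[THEN I]
      \<comment> \<open>For the two squares \<open>I\<close> is applied with \<open>g = 0\<close>,
        hence \<open>diff_0_right\<close>.\<close>
      by (elim insertE emptyE; hypsubst; simp only: free_eval_simps free_eval_gen free_eval_scal diff_0_right)
  qed
qed

end

lemma realization_parity: "realization q L g \<in> free_comp wpar (upar g)"
proof -
  \<comment> \<open>The four parity combinations are spelled out because the simplifier cannot guess
    the summands \<open>p + p'\<close> of \<open>free_comp_mult\<close> from the goal.\<close>
  have mult: "f \<in> free_comp wpar 0 \<Longrightarrow> g \<in> free_comp wpar 0 \<Longrightarrow> f * g \<in> free_comp wpar 0"
    "f \<in> free_comp wpar 1 \<Longrightarrow> g \<in> free_comp wpar 1 \<Longrightarrow> f * g \<in> free_comp wpar 0"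
    "f \<in> free_comp wpar 0 \<Longrightarrow> g \<in> free_comp wpar 1 \<Longrightarrow> f * g \<in> free_comp wpar 1"
    "f \<in> free_comp wpar 1 \<Longrightarrow> g \<in> free_comp wpar 0 \<Longrightarrow> f * g \<in> free_comp wpar 1"
    for f g :: "(wgen, 'a) free_alg"
    using free_comp_mult[of f wpar _ g] by fastforce+
  have gens: "gen h \<in> free_comp wpar p" if "wpar h = p" for h p
    using free_comp_gen[of h wpar] that by simp
  show ?thesis
    by (cases "(q, L, g)" rule: realization.cases)
      (simp_all add: mult gens free_comp_add free_comp_diff free_comp_uminus free_comp_scale)
qed

lemma qvar_neq: "qvar \<noteq> 0" "qvar * qvar \<noteq> 1"
  by (simp_all add: qvar_def Zero_fract_def One_fract_def eq_fract one_pCons)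

text \<open>\<open>\<iota>\<close> makes \<open>'k\<close> an extension of the base field, large
  enough to contain \<open>L\<close> in the role of q^lambda_1. Requiring \<open>extensional\<close>
  fixes the values outside the carrier, so that uniqueness can hold for functions.\<close>

theorem theorem2:
  fixes \<iota> :: "complex poly fract \<Rightarrow> 'k::field"
    and q L :: 'k
  assumes "\<iota> \<in> ring_hom ring_of_type_algebra ring_of_type_algebra"
    and "q = \<iota> qvar"
    and "L \<noteq> 0"
  shows "\<exists>!\<rho>. \<rho> \<in> extensional (carrier (Uq_gl21 q)) \<and>
    \<rho> \<in> superalgebra_hom (Uq_gl21 q) (W_alg q) \<and>
    \<rho> (ucls q (gen E12)) = wcls q ap \<and>
    \<rho> (ucls q (elem13 q)) = wcls q (qxi * bp) \<and>
    \<rho> (ucls q (gen E23)) =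
      wcls q (- (q \<cdot> (am * bp)) + qx * (bm * bp + q \<cdot> (bp * bm)) * e23) \<and>
    \<rho> (ucls q (gen (K I1))) = wcls q ((L \<cdot> qx) * (bm * bp + q \<cdot> (bp * bm))) \<and>
    \<rho> (ucls q (gen (K I2))) = wcls q (qxi * k2) \<and>
    \<rho> (ucls q (gen (K I3))) = wcls q ((bm * bp + inverse q \<cdot> (bp * bm)) * k3) \<and>
    (\<forall>i. \<rho> (ucls q (gen (Kinv i))) = inv\<^bsub>W_alg q\<^esub> (\<rho> (ucls q (gen (K i))))) \<and>
    \<rho> (ucls q (gen E32)) = wcls q (inverse q \<cdot> (ap * bm * k2 * k3) + e32) \<and>
    \<rho> (ucls q (gen E21)) =
      wcls q (- (inverse (q - inverse q) \<cdot> am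
                 * ((L * inverse q) \<cdot> qx * (bm * bp + q \<cdot> (bp * bm)) * k2i
                    - (inverse L * q) \<cdot> qxi * (bm * bp + inverse q \<cdot> (bp * bm)) * k2))
              - inverse L \<cdot> (bm * e23 * k2)) \<and>
    \<rho> (ucls q (elem31 q)) =
      wcls q (ap * am * bm * ((L * inverse q) \<cdot> qx) * k3
              + am * ((L * q powi (-2)) \<cdot> qx) * (bm * bp + q \<cdot> (bp * bm)) * k2i * e32
              + inverse q \<cdot> bm * (inverse (q - inverse q) \<cdot> (L \<cdot> k3 - inverse L \<cdot> k3i)))"
proof -
  have hom: "\<iota> (x * y) = \<iota> x * \<iota> y" "\<iota> (x + y) = \<iota> x + \<iota> y" "\<iota> 1 = 1" for x y
    using assms(1) by (auto simp: ring_hom_def ring_of_type_algebra_def)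
  \<comment> \<open>A homomorphism of fields sends units to units, so the two inequalities for
    \<open>qvar\<close> carry over to \<open>q\<close>.\<close>
  have nz: "\<iota> x \<noteq> 0" if "x \<noteq> 0" for x
    using hom(1)[of x "inverse x"] hom(3) that by auto
  have q_nz: "q \<noteq> 0" using nz qvar_neq assms(2) by simp
  have "q * q - 1 = \<iota> (qvar * qvar - 1)"
    using hom(2)[of "qvar * qvar - 1" 1] by (simp add: assms(2) hom)
  then have qq: "q * q \<noteq> 1" using nz[of "qvar * qvar - 1"] qvar_neq by auto
  \<comment> \<open>The three \<open>refl\<close> instantiate \<open>p\<close>, \<open>M\<close> and
    \<open>d\<close> by the inverses they stand for.\<close>
  note asm = q_nz qq assms(3) refl refl refl
  let ?\<theta> = "realization q L"
  obtain \<rho> where ext: "\<rho> \<in> extensional (carrier (Uq_gl21 q))"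
    and super: "\<rho> \<in> superalgebra_hom (Uq_gl21 q) (W_alg q)"
    and \<rho>: "\<And>f. \<rho> (ucls q f) = wcls q (free_eval ?\<theta> f)"
    using ex_presented_hom[where \<theta> = ?\<theta>, OF realization_rels[OF asm] realization_parity]
    unfolding Uq_gl21_def W_alg_def ucls_def wcls_def by blast
  have inv: "wcls q (?\<theta> (Kinv i)) = inv\<^bsub>W_alg q\<^esub> wcls q (?\<theta> (K i))" for i
    using presented_inv[of "W_rels q" "?\<theta> (K i)" "?\<theta> (Kinv i)" wpar]
      realization_K_Kinv[OF asm, of i]
    by (simp add: W_alg_def wcls_def)
  show ?thesis
  proof (rule ex1I[of _ \<rho>], goal_cases)
    case 1
    show ?case
      using ext super inv by (auto simp: \<rho> realization_E13[OF asm] realization_E31[OF asm])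
  next
    case (2 \<rho>')
    then have \<rho>': "\<rho>' \<in> extensional (carrier (Uq_gl21 q))"
      "\<rho>' \<in> superalgebra_hom (Uq_gl21 q) (W_alg q)"
      by blast+
    have K: "\<rho>' (ucls q (gen (K i))) = \<rho> (ucls q (gen (K i)))" for i
      using 2 by (cases i) (simp_all add: \<rho>)
    have "\<rho>' (ucls q (gen g)) = \<rho> (ucls q (gen g))" for g
    proof (cases g)
      \<comment> \<open>Here the statement prescribes an inverse instead of a formula; it is
        determined by the value at \<open>K i\<close>.\<close>
      case (Kinv i)
      have "\<rho>' (ucls q (gen (Kinv i))) = inv\<^bsub>W_alg q\<^esub> \<rho>' (ucls q (gen (K i)))"
        using 2 by blast
      then show ?thesis unfolding Kinv K by (simp add: \<rho> inv)
    qed (use 2 K in \<open>simp_all add: \<rho>\<close>)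
    then show ?case
      using \<rho>' ext super unfolding Uq_gl21_def W_alg_def ucls_def
      by (intro presented_hom_eqI[of \<rho>' upar "gl21_rels q" wpar "W_rels q" \<rho>]) auto
  qed
qed

end
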